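(* Let $(G,u)$ be a unital Abelian $\ell$-group, let $\mathcal{B}$ be a Boolean algebra, and let $\mu:\mathcal{B}\to G$ be positive, finitely additive on disjoint joins, strictly positive, normalized by $\mu(1)=u$, and interval divisible. For all $x,y,z\in\Gamma(G,u)$, $$(x\star y)\star z=x\star(y\star z)=\left[(x+y+z-2u)\vee0,\ x\wedge y\wedge z\right]_G.$$
   Context: A unital Abelian $\ell$-group $(G,u)$ is an Abelian lattice-ordered group $G$ with a strong order unit $u$. $\Gamma(G,u)=\{g\in G:0\le g\le u\}$ and $[r,s]_G=\{g\in G:r\le g\le s\}$. For $\mu:\mathcal{B}\to G$: positive means $\mu(a)\ge0$ for all $a$; finitely additive means $\mu(a\vee b)=\mu(a)+\mu(b)$ whenever $a\wedge b=0$; strictly positive means $\mu(a)=0$ implies $a=0$; interval divisible means that whenever $g\in G$ and $0\le g\le\mu(a)$ there is $b\le a$ in $\mathcal{B}$ with $\mu(b)=g$. For $x,y\in\Gamma(G,u)$, $x\star y:=\{\mu(a\wedge b):a,b\in\mathcal{B},\ \mu(a)=x,\ \mu(b)=y\}\subseteq\Gamma(G,u)$. For nonempty $A\subseteq\Gamma(G,u)$, $A\star z:=\bigcup_{a\in A}(a\star z)$ and $z\star A:=\bigcup_{a\in A}(z\star a)$. On $G$, $\wedge,\vee$ denote the lattice operations; on $\mathcal{B}$, the Boolean operations. *)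

theory Defs
  imports "HOL-Library.Lattice_Algebras"
begin

text \<open>
  An Abelian lattice-ordered group is a type of class \<open>lattice_ab_group_add\<close>, and a Boolean
  algebra is a type of class \<open>boolean_algebra\<close>; both classes include the one-element structure.
  The multiple \<open>n u\<close> is written as an \<open>n\<close>-fold sum, since the group has no
  multiplication.
\<close>

definition strong_order_unit :: "'g::lattice_ab_group_add \<Rightarrow> bool" where
  "strong_order_unit u \<longleftrightarrow> 0 \<le> u \<and> (\<forall>g. \<exists>n::nat. g \<le> (\<Sum>i<n. u))"

definition unit_interval :: "'g::lattice_ab_group_add \<Rightarrow> 'g set" where
  "unit_interval u = {0..u}"

definition positive :: "('b::boolean_algebra \<Rightarrow> 'g::lattice_ab_group_add) \<Rightarrow> bool" where
  "positive \<mu> \<longleftrightarrow> (\<forall>a. 0 \<le> \<mu> a)"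

definition finitely_additive :: "('b::boolean_algebra \<Rightarrow> 'g::lattice_ab_group_add) \<Rightarrow> bool" where
  "finitely_additive \<mu> \<longleftrightarrow> (\<forall>a b. inf a b = bot \<longrightarrow> \<mu> (sup a b) = \<mu> a + \<mu> b)"

definition strictly_positive :: "('b::boolean_algebra \<Rightarrow> 'g::lattice_ab_group_add) \<Rightarrow> bool" where
  "strictly_positive \<mu> \<longleftrightarrow> (\<forall>a. \<mu> a = 0 \<longrightarrow> a = bot)"

definition interval_divisible :: "('b::boolean_algebra \<Rightarrow> 'g::lattice_ab_group_add) \<Rightarrow> bool" where
  "interval_divisible \<mu> \<longleftrightarrow> (\<forall>a g. 0 \<le> g \<and> g \<le> \<mu> a \<longrightarrow> (\<exists>b\<le>a. \<mu> b = g))"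

definition hyperprod :: "('b::boolean_algebra \<Rightarrow> 'g::lattice_ab_group_add) \<Rightarrow> 'g \<Rightarrow> 'g \<Rightarrow> 'g set" where
  "hyperprod \<mu> x y = {\<mu> (inf a b) | a b. \<mu> a = x \<and> \<mu> b = y}"

definition set_hyperprod :: "('b::boolean_algebra \<Rightarrow> 'g::lattice_ab_group_add) \<Rightarrow> 'g set \<Rightarrow> 'g \<Rightarrow> 'g set" where
  "set_hyperprod \<mu> A z = (\<Union>a\<in>A. hyperprod \<mu> a z)"

definition hyperprod_set :: "('b::boolean_algebra \<Rightarrow> 'g::lattice_ab_group_add) \<Rightarrow> 'g \<Rightarrow> 'g set \<Rightarrow> 'g set" where
  "hyperprod_set \<mu> z A = (\<Union>a\<in>A. hyperprod \<mu> z a)"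

end

theory Submission
  imports Defs
begin

text \<open>
  Splitting the top element as \<open>a, -a\<close> with \<open>\<mu> a = x\<close> and choosing the two parts of \<open>b\<close> below
  \<open>a\<close> and \<open>-a\<close> separately shows that \<open>x \<star> y\<close> is the whole interval
  \<open>[(x + y - u) \<or> 0, x \<and> y]\<close>. An element \<open>w\<close> of the ternary interval is then reached through
  the intermediate value \<open>w \<or> (x + y - u)\<close> of \<open>x \<star> y\<close>. The other bracketing follows by
  commutativity of \<open>\<star>\<close>.
\<close>

lemma positive_additive_mono:
  assumes "positive \<mu>" "finitely_additive \<mu>" "a \<le> b"
  shows "\<mu> a \<le> \<mu> b"
proof -
  have "\<mu> (sup a (inf b (- a))) = \<mu> a + \<mu> (inf b (- a))"
    using assms(2) unfolding finitely_additive_def by (simp add: inf_left_commute)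
  moreover have "sup a (inf b (- a)) = b"
    using assms(3) by (simp add: sup_inf_distrib1 sup_absorb2)
  ultimately show ?thesis
    using assms(1) by (simp add: positive_def)
qed

text \<open>The difference \<open>inf b (- a)\<close> is disjoint from \<open>a\<close> and from
  \<open>inf a b\<close>. It completes \<open>a\<close> to \<open>sup a b\<close> and
  \<open>inf a b\<close> to \<open>b\<close>, so its measure cancels between the two
  splittings.\<close>

lemma finitely_additive_modular:
  assumes "finitely_additive \<mu>"
  shows "\<mu> (sup a b) + \<mu> (inf a b) = \<mu> a + \<mu> b"
proof -
  have "\<mu> (sup a (inf b (- a))) = \<mu> a + \<mu> (inf b (- a))"
    using assms unfolding finitely_additive_def by (simp add: inf_left_commute)
  moreover have "\<mu> (sup (inf b (- a)) (inf a b)) = \<mu> (inf b (- a)) + \<mu> (inf a b)"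
    using assms unfolding finitely_additive_def by (simp add: inf_assoc inf_left_commute)
  moreover have "sup a (inf b (- a)) = sup a b"
    by (simp add: sup_inf_distrib1)
  moreover have "sup (inf b (- a)) (inf a b) = b"
    by (simp add: inf_commute[of a b] flip: inf_sup_distrib1)
  ultimately show ?thesis
    by (simp add: add.assoc)
qed

text \<open>Here \<open>y\<close> may be any group element: outside \<open>{0..\<mu> top}\<close>
  both sides are empty.\<close>

lemma hyperprod_eq_interval:
  assumes "positive \<mu>" "finitely_additive \<mu>" "interval_divisible \<mu>"
    and "x \<in> {0..\<mu> top}"
  shows "hyperprod \<mu> x y = {sup (x + y - \<mu> top) 0 .. inf x y}"
proof (intro equalityI subsetI)
  fix t assume "t \<in> hyperprod \<mu> x y"
  then obtain a b where ab: "t = \<mu> (inf a b)" "\<mu> a = x" "\<mu> b = y"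
    unfolding hyperprod_def by blast
  note mono = positive_additive_mono[OF assms(1,2)]
  \<comment> \<open>By modularity \<open>x + y = \<mu> (sup a b) + t\<close>, and the join has
    measure at most \<open>\<mu> top\<close>.\<close>
  have "x + y \<le> \<mu> top + t"
    using finitely_additive_modular[OF assms(2), of a b] mono[of "sup a b" top] ab
    by (metis add_right_mono top_greatest)
  then have "x + y - \<mu> top \<le> t"
    by (simp add: diff_le_eq add.commute)
  moreover have "0 \<le> t" "t \<le> x" "t \<le> y"
    using ab mono assms(1) by (auto simp: positive_def)
  ultimately show "t \<in> {sup (x + y - \<mu> top) 0 .. inf x y}"
    by simp
next
  fix t assume "t \<in> {sup (x + y - \<mu> top) 0 .. inf x y}"
  then have t: "x + y - \<mu> top \<le> t" "0 \<le> t" "t \<le> x" "t \<le> y"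
    by auto
  have divisible: "\<exists>b\<le>a. \<mu> b = g" if "0 \<le> g" "g \<le> \<mu> a" for a g
    using assms(3) that unfolding interval_divisible_def by blast
  have additive: "\<mu> (sup a b) = \<mu> a + \<mu> b" if "inf a b = bot" for a b
    using assms(2) that unfolding finitely_additive_def by blast
  obtain a where a: "\<mu> a = x"
    using divisible[of x top] assms(4) by auto
  \<comment> \<open>The set sought is \<open>sup c d\<close>: \<open>c\<close> is to be its
    intersection with \<open>a\<close>, and \<open>d\<close> below \<open>- a\<close> has to supply
    the missing measure \<open>y - t\<close>.\<close>
  obtain c where c: "c \<le> a" "\<mu> c = t"
    using divisible[of t a] t a by auto
  have "\<mu> top = x + \<mu> (- a)"
    using additive[of a "- a"] a by simp
  \<comment> \<open>The lower bound on \<open>t\<close> says exactly that the missing measure fits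
    into the complement of \<open>a\<close>.\<close>
  then have "y - t \<le> \<mu> (- a)"
    using t(1) by (simp add: algebra_simps)
  then obtain d where d: "d \<le> - a" "\<mu> d = y - t"
    using divisible[of "y - t" "- a"] t by auto
  have ad: "inf a d = bot"
    using d(1) by (simp add: inf_commute[of a d] inf_shunt)
  then have "inf c d = bot"
    using c(1) by (metis bot.extremum_uniqueI inf_mono order_refl)
  then have "\<mu> (sup c d) = y"
    using additive[of c d] c d by simp
  moreover have "inf a (sup c d) = c"
    using c(1) ad by (simp add: inf_sup_distrib1 inf_absorb2)
  ultimately show "t \<in> hyperprod \<mu> x y"
    unfolding hyperprod_def using a c(2) by (intro CollectI exI[of _ a] exI[of _ "sup c d"]) simp
qed

lemma hyperprod_commute: "hyperprod \<mu> x y = hyperprod \<mu> y x"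
  unfolding hyperprod_def by (metis inf_commute)

text \<open>This turns the right bracketing into a left one, so that only one ternary product has to
  be computed.\<close>

lemma hyperprod_set_eq_set_hyperprod: "hyperprod_set \<mu> x A = set_hyperprod \<mu> A x"
  unfolding hyperprod_set_def set_hyperprod_def by (simp add: hyperprod_commute)

lemma set_hyperprod_eq_interval:
  assumes "positive \<mu>" "finitely_additive \<mu>" "interval_divisible \<mu>"
    and "x \<in> {0..\<mu> top}" "y \<in> {0..\<mu> top}" "z \<in> {0..\<mu> top}"
  shows "set_hyperprod \<mu> (hyperprod \<mu> x y) z
    = {sup (x + y + z - (\<mu> top + \<mu> top)) 0 .. inf (inf x y) z}"
proof -
  define u where "u = \<mu> top"
  have xyz: "x \<le> u" "y \<le> u" "z \<le> u"
    using assms(4-6) by (auto simp: u_def)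
  have xy: "hyperprod \<mu> x y = {sup (x + y - u) 0 .. inf x y}"
    unfolding u_def by (rule hyperprod_eq_interval[OF assms(1-4)])
  \<comment> \<open>Each such \<open>t\<close> satisfies \<open>0 \<le> t \<le> x \<le> u\<close>,
    so the binary formula applies again.\<close>
  have tz: "hyperprod \<mu> t z = {sup (t + z - u) 0 .. inf t z}" if "t \<in> hyperprod \<mu> x y" for t
    unfolding u_def
  proof (rule hyperprod_eq_interval[OF assms(1-3)])
    show "t \<in> {0..\<mu> top}"
      using that xyz(1) unfolding xy u_def by auto
  qed
  have "set_hyperprod \<mu> (hyperprod \<mu> x y) z = {sup (x + y + z - (u + u)) 0 .. inf (inf x y) z}"
  proof (intro equalityI subsetI)
    fix w assume "w \<in> set_hyperprod \<mu> (hyperprod \<mu> x y) z"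
    then obtain t where "t \<in> hyperprod \<mu> x y" "w \<in> hyperprod \<mu> t z"
      unfolding set_hyperprod_def by blast
    then have tw: "x + y - u \<le> t" "t \<le> x" "t \<le> y" "t + z - u \<le> w" "0 \<le> w" "w \<le> t" "w \<le> z"
      using tz xy by auto
    have "x + y + z - (u + u) = (x + y - u) + (z - u)"
      by (simp add: algebra_simps)
    also have "\<dots> \<le> t + (z - u)"
      using tw(1) by (rule add_right_mono)
    also have "\<dots> \<le> w"
      using tw(4) by (simp add: algebra_simps)
    finally show "w \<in> {sup (x + y + z - (u + u)) 0 .. inf (inf x y) z}"
      using tw by auto
  next
    fix w assume "w \<in> {sup (x + y + z - (u + u)) 0 .. inf (inf x y) z}"
    then have w: "x + y + z - (u + u) \<le> w" "0 \<le> w" "w \<le> x" "w \<le> y" "w \<le> z"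
      by auto
    \<comment> \<open>The least candidate: \<open>t\<close> must dominate both \<open>w\<close> and
      \<open>x + y - u\<close>, while the second product bounds it above by
      \<open>w + (u - z)\<close>.\<close>
    define t where "t = sup w (x + y - u)"
    have "w \<le> t" "x + y - u \<le> t"
      by (simp_all add: t_def)
    moreover from \<open>w \<le> t\<close> w(2) have "0 \<le> t"
      by (rule order_trans[rotated])
    \<comment> \<open>For the joinand \<open>x + y - u\<close>, the bound by \<open>x\<close> is
      \<open>y \<le> u\<close> and the bound by \<open>y\<close> is
      \<open>x \<le> u\<close>.\<close>
    moreover have "t \<le> x" "t \<le> y"
      using w(3,4) xyz(1,2) by (simp_all add: t_def diff_le_eq add.commute[of x])
    ultimately have t: "t \<in> hyperprod \<mu> x y"
      unfolding xy by simp
    \<comment> \<open>The upper bound on \<open>t\<close> is checked on each joinand: for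
      \<open>w\<close> it is \<open>z \<le> u\<close>, for \<open>x + y - u\<close> it is the
      ternary lower bound on \<open>w\<close>.\<close>
    have "w \<le> w + (u - z)"
      using xyz(3) by simp
    moreover have "x + y - u \<le> w + (u - z)"
      using w(1) by (simp add: algebra_simps)
    ultimately have "t \<le> w + (u - z)"
      by (simp add: t_def)
    then have "t + z - u \<le> w"
      by (simp add: algebra_simps)
    then have "w \<in> hyperprod \<mu> t z"
      unfolding tz[OF t] using w \<open>w \<le> t\<close> by simp
    then show "w \<in> set_hyperprod \<mu> (hyperprod \<mu> x y) z"
      unfolding set_hyperprod_def using t by blast
  qed
  then show ?thesis
    by (simp only: u_def)
qed

theorem theorem10:
  fixes u :: "'g::lattice_ab_group_add"
    and \<mu> :: "'b::boolean_algebra \<Rightarrow> 'g"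
    and x y z :: 'g
  assumes "strong_order_unit u"
    and "positive \<mu>"
    and "finitely_additive \<mu>"
    and "strictly_positive \<mu>"
    and "\<mu> top = u"
    and "interval_divisible \<mu>"
    and "x \<in> unit_interval u"
    and "y \<in> unit_interval u"
    and "z \<in> unit_interval u"
  shows "set_hyperprod \<mu> (hyperprod \<mu> x y) z = hyperprod_set \<mu> x (hyperprod \<mu> y z)
    \<and> hyperprod_set \<mu> x (hyperprod \<mu> y z) = {sup (x + y + z - (u + u)) 0 .. inf (inf x y) z}"
proof -
  have u: "{0..\<mu> top} = unit_interval u"
    using assms(5) by (simp add: unit_interval_def)
  note interval = set_hyperprod_eq_interval[OF assms(2,3,6), unfolded u, unfolded assms(5)]
  \<comment> \<open>After commuting, the product is the left bracketing of the rotated triple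
    \<open>y\<close>, \<open>z\<close>, \<open>x\<close>; the interval is symmetric in the three
    elements, so the rotation does not change it.\<close>
  have "hyperprod_set \<mu> x (hyperprod \<mu> y z) = {sup (y + z + x - (u + u)) 0 .. inf (inf y z) x}"
    unfolding hyperprod_set_eq_set_hyperprod by (rule interval[OF assms(8,9,7)])
  also have "\<dots> = {sup (x + y + z - (u + u)) 0 .. inf (inf x y) z}"
    by (simp add: ac_simps)
  finally show ?thesis
    using interval[OF assms(7-9)] by simp
qed

end
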